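(* Let $f:X\to X'$ be a quasi-isometric map between metric spaces $X$, $X'$. Then $$\operatorname{hypdim}X\le\operatorname{hypdim}X'.$$
   Context: Quasi-isometric map: there are $\Lambda\ge1$, $\lambda\ge0$ with $\frac1\Lambda|x-x'|-\lambda\le|f(x)-f(x')|\le\Lambda|x-x'|+\lambda$ for all $x,x'\in X$ (no coboundedness of the image is required). Boundedness: let $\mathcal N$ be the set of functions $N:(0,1)\to\mathbb N$ and $\mathcal R$ the set of functions $R:(0,1)\to[0,\infty)$. A metric space $A$ (in particular a subset of a metric space, with the induced metric) is $(N,R)$-bounded if for every $\rho\in(0,1)$ every ball of radius $r\ge R(\rho)$ in $A$ contains at most $N(\rho)$ points which are $\rho r$-separated (pairwise distances $\ge\rho r$). It is $N$-bounded if it is $(N,R)$-bounded for some $R\in\mathcal R$. Uniformly $N$-bounded coverings: given $N\in\mathcal N$, a covering $\mathcal U$ of a metric space $X$ is uniformly $N$-bounded if (i) there is $R\in\mathcal R$ such that every element of $\mathcal U$ is $(N,R)$-bounded, and (ii) any finite union of elements of $\mathcal U$ is $N$-bounded. Lebesgue number: $L(\mathcal U)=\inf_{x\in X}\max\{\operatorname{dist}(x,X\setminus U): U\in\mathcal U\}$ (with $\operatorname{dist}(x,\emptyset)=\infty$). Hyperbolic dimension: $\operatorname{hypdim}X$ is the minimal integer $n\ge 0$ (or $\infty$ if there is none) such that for every $d>0$ there are a function $N\in\mathcal N$ and a uniformly $N$-bounded covering $\mathcal U$ of $X$ with $L(\mathcal U)\ge d$ and multiplicity $\le n+1$ (every point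 lies in at most $n+1$ elements). *)

theory Defs
  imports "HOL-Analysis.Analysis"
begin

text \<open>A metric space is a carrier \<open>M\<close> with a distance function \<open>d\<close> such that
  \<^term>\<open>Metric_space M d\<close>; a subset \<open>A\<close> with the induced metric is given by \<open>A\<close> and the same \<open>d\<close>.\<close>

definition quasi_isometric_map ::
  "'a set \<Rightarrow> ('a \<Rightarrow> 'a \<Rightarrow> real) \<Rightarrow> 'b set \<Rightarrow> ('b \<Rightarrow> 'b \<Rightarrow> real) \<Rightarrow> ('a \<Rightarrow> 'b) \<Rightarrow> bool" where
  "quasi_isometric_map M d M' d' f \<longleftrightarrow>
     f \<in> M \<rightarrow> M' \<and>
     (\<exists>\<Lambda> l :: real. \<Lambda> \<ge> 1 \<and> l \<ge> 0 \<and>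
        (\<forall>x\<in>M. \<forall>x'\<in>M. 1 / \<Lambda> * d x x' - l \<le> d' (f x) (f x') \<and>
                           d' (f x) (f x') \<le> \<Lambda> * d x x' + l))"

text \<open>Functions on the interval \<open>(0,1)\<close> are represented by total functions on the reals whose values
  outside \<open>(0,1)\<close> are never used. Balls are open; replacing them by closed balls does not change
  the hyperbolic dimension.\<close>

definition NR_bounded ::
  "(real \<Rightarrow> nat) \<Rightarrow> (real \<Rightarrow> real) \<Rightarrow> 'a set \<Rightarrow> ('a \<Rightarrow> 'a \<Rightarrow> real) \<Rightarrow> bool" where
  "NR_bounded N R A d \<longleftrightarrow>
     (\<forall>\<rho>\<in>{0<..<1}. \<forall>a\<in>A. \<forall>r\<ge>R \<rho>.
        \<forall>S \<subseteq> Metric_space.mball A d a r.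
          pairwise (\<lambda>x y. d x y \<ge> \<rho> * r) S \<longrightarrow> finite S \<and> card S \<le> N \<rho>)"

definition radius_functions :: "(real \<Rightarrow> real) set" where
  "radius_functions = {R. \<forall>\<rho>\<in>{0<..<1}. R \<rho> \<ge> 0}"

definition N_bounded :: "(real \<Rightarrow> nat) \<Rightarrow> 'a set \<Rightarrow> ('a \<Rightarrow> 'a \<Rightarrow> real) \<Rightarrow> bool" where
  "N_bounded N A d \<longleftrightarrow> (\<exists>R\<in>radius_functions. NR_bounded N R A d)"

definition covering :: "'a set \<Rightarrow> 'a set set \<Rightarrow> bool" where
  "covering M \<U> \<longleftrightarrow> (\<forall>U\<in>\<U>. U \<subseteq> M) \<and> M \<subseteq> \<Union>\<U>"

definition uniformly_N_bounded ::
  "(real \<Rightarrow> nat) \<Rightarrow> 'a set set \<Rightarrow> ('a \<Rightarrow> 'a \<Rightarrow> real) \<Rightarrow> bool" where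
  "uniformly_N_bounded N \<U> d \<longleftrightarrow>
     (\<exists>R\<in>radius_functions. \<forall>U\<in>\<U>. NR_bounded N R U d) \<and>
     (\<forall>\<F>\<subseteq>\<U>. finite \<F> \<longrightarrow> N_bounded N (\<Union>\<F>) d)"

text \<open>Infima are taken in \<^typ>\<open>ennreal\<close>, so the distance to the empty set is \<open>\<infinity>\<close>.\<close>

definition dist_to_set :: "('a \<Rightarrow> 'a \<Rightarrow> real) \<Rightarrow> 'a \<Rightarrow> 'a set \<Rightarrow> ennreal" where
  "dist_to_set d x A = (INF y\<in>A. ennreal (d x y))"

text \<open>For a covering of finite multiplicity the supremum below is a maximum: only the
  finitely many \<open>U\<close> containing \<open>x\<close> contribute a nonzero value.\<close>

definition Lebesgue_number :: "'a set \<Rightarrow> ('a \<Rightarrow> 'a \<Rightarrow> real) \<Rightarrow> 'a set set \<Rightarrow> ennreal" where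
  "Lebesgue_number M d \<U> = (INF x\<in>M. SUP U\<in>\<U>. dist_to_set d x (M - U))"

definition multiplicity_le :: "'a set \<Rightarrow> 'a set set \<Rightarrow> nat \<Rightarrow> bool" where
  "multiplicity_le M \<U> m \<longleftrightarrow> (\<forall>x\<in>M. finite {U\<in>\<U>. x \<in> U} \<and> card {U\<in>\<U>. x \<in> U} \<le> m)"

text \<open>The infimum of a set of naturals in \<^typ>\<open>enat\<close> is its minimum, or \<open>\<infinity>\<close> if the set is empty.\<close>

definition hypdim :: "'a set \<Rightarrow> ('a \<Rightarrow> 'a \<Rightarrow> real) \<Rightarrow> enat" where
  "hypdim M d = (INF n \<in> {n :: nat. \<forall>\<delta>>0. \<exists>N \<U>. covering M \<U> \<and> uniformly_N_bounded N \<U> d \<and>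
       Lebesgue_number M d \<U> \<ge> ennreal \<delta> \<and> multiplicity_le M \<U> (n + 1)}. enat n)"

end

(* A covering of X' pulls back along f to a covering of X with no larger multiplicity. The upper
   estimate for f controls the Lebesgue number. Both estimates together show that f sends a
   rho r-separated subset of an r-ball injectively to a (rho / 4 Lambda^2) r'-separated subset of an
   r'-ball, r' = 2 Lambda r, once r is so large that the additive constant is negligible; hence
   preimages of N-bounded sets are bounded with N(rho / 4 Lambda^2) in place of N(rho), and the
   threshold radius depends only on the one downstairs. *)
theory Submission
  imports Defs
begin

text \<open>The second entry of the threshold makes
  \<open>2 * \<Lambda> * l \<le> \<rho> * r\<close>, so \<open>l\<close> is at most half of the
  separation \<open>\<rho> * r / \<Lambda>\<close> that survives the lower estimate; the summand 1
  keeps \<open>r\<close> positive even if \<open>l = 0\<close>.\<close>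

lemma NR_bounded_preimage:
  fixes \<Lambda> l :: real
  assumes M: "Metric_space M d" and M': "Metric_space M' d'" and f: "f \<in> M \<rightarrow> M'"
    and \<Lambda>: "\<Lambda> \<ge> 1" and l: "l \<ge> 0"
    and lower: "\<And>x y. x \<in> M \<Longrightarrow> y \<in> M \<Longrightarrow> d x y / \<Lambda> - l \<le> d' (f x) (f y)"
    and upper: "\<And>x y. x \<in> M \<Longrightarrow> y \<in> M \<Longrightarrow> d' (f x) (f y) \<le> \<Lambda> * d x y + l"
    and A: "A \<subseteq> M'" and bdd: "NR_bounded N R A d'"
  shows "NR_bounded (\<lambda>\<rho>. N (\<rho> / (4 * \<Lambda>\<^sup>2)))
    (\<lambda>\<rho>. max (R (\<rho> / (4 * \<Lambda>\<^sup>2))) (2 * \<Lambda> * l / \<rho> + 1)) (M \<inter> f -` A) d"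
  unfolding NR_bounded_def
proof (intro ballI allI impI)
  fix \<rho> a r S
  \<comment> \<open>Chosen so that \<open>\<sigma> * (2 * \<Lambda> * r) = \<rho> * r / (2 *
    \<Lambda>)\<close>, the part of the separation left after paying for \<open>l\<close>.\<close>
  define \<sigma> where "\<sigma> = \<rho> / (4 * \<Lambda>\<^sup>2)"
  assume \<rho>: "\<rho> \<in> {0<..<1}" and a: "a \<in> M \<inter> f -` A"
    and r: "max (R (\<rho> / (4 * \<Lambda>\<^sup>2))) (2 * \<Lambda> * l / \<rho> + 1) \<le> r"
    and S: "S \<subseteq> Metric_space.mball (M \<inter> f -` A) d a r"
    and sep: "pairwise (\<lambda>x y. \<rho> * r \<le> d x y) S"
  interpret A: Metric_space A d'
    using Metric_space.subspace[OF M' A] .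
  interpret P: Metric_space "M \<inter> f -` A" d
    using Metric_space.subspace[OF M] by blast
  have "2 * \<Lambda> * l / \<rho> \<ge> 0"
    using \<rho> \<Lambda> l by simp
  then have r1: "r \<ge> 1" and rR: "r \<ge> R \<sigma>" and rl: "2 * \<Lambda> * l / \<rho> \<le> r"
    using r by (auto simp: \<sigma>_def)
  have rl: "2 * \<Lambda> * l \<le> \<rho> * r"
    using rl \<rho> by (simp add: field_simps)
  have "\<Lambda>\<^sup>2 \<ge> 1"
    using \<Lambda> by (simp add: one_le_power)
  then have "4 * \<Lambda>\<^sup>2 > 0" and "\<rho> < 4 * \<Lambda>\<^sup>2"
    using \<rho> by auto
  then have \<sigma>: "\<sigma> \<in> {0<..<1}"
    using \<rho> unfolding \<sigma>_def by (simp only: greaterThanLessThan_iff divide_less_eq_1_pos) simp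
  have "r \<le> 2 * \<Lambda> * r"
    using \<Lambda> r1 by simp
  then have rR': "R \<sigma> \<le> 2 * \<Lambda> * r"
    using rR by linarith
  have SM: "x \<in> M" "f x \<in> A" "d a x < r" if "x \<in> S" for x
    using S that by (auto simp: P.in_mball)
  have "\<rho> * r \<le> r"
    using \<rho> r1 by simp
  then have "2 * \<Lambda> * l \<le> r"
    using rl by linarith
  moreover have "l \<le> \<Lambda> * l" and "r \<le> \<Lambda> * r"
    using \<Lambda> l r1 by (simp_all add: mult_le_cancel_right1)
  \<comment> \<open>This absorbs the additive constant: an image distance below
    \<open>\<Lambda> * r + l\<close> is below \<open>2 * \<Lambda> * r\<close>, the radius used in
    the target.\<close>
  ultimately have l_le: "l \<le> \<Lambda> * r"
    using l by linarith
  have ball: "f ` S \<subseteq> A.mball (f a) (2 * \<Lambda> * r)"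
  proof clarify
    fix x assume x: "x \<in> S"
    have "\<Lambda> * d a x < \<Lambda> * r"
      using SM(3)[OF x] \<Lambda> by simp
    then have "d' (f a) (f x) < 2 * \<Lambda> * r"
      using upper[of a x] a SM(1)[OF x] l_le by auto
    then show "f x \<in> A.mball (f a) (2 * \<Lambda> * r)"
      using a SM(2)[OF x] by (simp add: A.in_mball)
  qed
  have sep': "\<sigma> * (2 * \<Lambda> * r) \<le> d' (f x) (f y)" if "x \<in> S" "y \<in> S" "x \<noteq> y" for x y
  proof -
    have "\<rho> * r \<le> d x y"
      using sep that by (auto simp: pairwise_def)
    then have "\<rho> * r / \<Lambda> \<le> d x y / \<Lambda>"
      using \<Lambda> by (simp add: divide_right_mono)
    moreover have "l \<le> \<rho> * r / (2 * \<Lambda>)"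
      using rl \<Lambda> by (simp add: field_simps)
    moreover have "\<sigma> * (2 * \<Lambda> * r) = \<rho> * r / \<Lambda> - \<rho> * r / (2 * \<Lambda>)"
      using \<Lambda> by (simp add: \<sigma>_def field_simps power2_eq_square)
    ultimately show ?thesis
      using lower[of x y] SM(1) that by fastforce
  qed
  have pos: "\<sigma> * (2 * \<Lambda> * r) > 0"
    using \<sigma> \<Lambda> r1 by simp
  have inj: "inj_on f S"
  proof (rule inj_onI, rule ccontr)
    fix x y assume "x \<in> S" "y \<in> S" "f x = f y" "x \<noteq> y"
    then show False
      using sep'[of x y] pos SM(2)[of y] by simp
  qed
  have "pairwise (\<lambda>u v. \<sigma> * (2 * \<Lambda> * r) \<le> d' u v) (f ` S)"
    using sep' by (auto simp: pairwise_def)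
  then have "finite (f ` S) \<and> card (f ` S) \<le> N \<sigma>"
    using bdd \<sigma> rR' ball a unfolding NR_bounded_def by blast
  then show "finite S \<and> card S \<le> N (\<rho> / (4 * \<Lambda>\<^sup>2))"
    using inj by (simp add: finite_image_iff card_image \<sigma>_def)
qed

text \<open>The new bound depends only on \<open>N\<close> and \<Lambda>, and the new threshold only
  on the old one, \<Lambda> and \<open>l\<close>. So a common threshold stays common, and since
  preimages commute with unions, finite unions are handled by the same estimate.\<close>

lemma uniformly_N_bounded_preimage:
  fixes \<Lambda> l :: real
  assumes M: "Metric_space M d" and M': "Metric_space M' d'" and f: "f \<in> M \<rightarrow> M'"
    and \<Lambda>: "\<Lambda> \<ge> 1" and l: "l \<ge> 0"
    and lower: "\<And>x y. x \<in> M \<Longrightarrow> y \<in> M \<Longrightarrow> d x y / \<Lambda> - l \<le> d' (f x) (f y)"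
    and upper: "\<And>x y. x \<in> M \<Longrightarrow> y \<in> M \<Longrightarrow> d' (f x) (f y) \<le> \<Lambda> * d x y + l"
    and sub: "\<And>U. U \<in> \<U> \<Longrightarrow> U \<subseteq> M'" and bdd: "uniformly_N_bounded N \<U> d'"
  shows "uniformly_N_bounded (\<lambda>\<rho>. N (\<rho> / (4 * \<Lambda>\<^sup>2))) ((\<lambda>U. M \<inter> f -` U) ` \<U>) d"
proof -
  define T where
    "T = (\<lambda>R \<rho>. max (R (\<rho> / (4 * \<Lambda>\<^sup>2))) (2 * \<Lambda> * l / \<rho> + 1) :: real)"
  have T: "T R \<in> radius_functions" for R
  proof -
    have "0 \<le> T R \<rho>" if "\<rho> \<in> {0<..<1}" for \<rho>
    proof -
      have "0 \<le> 2 * \<Lambda> * l / \<rho>"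
        using that \<Lambda> l by simp
      then show ?thesis by (simp add: T_def max_def)
    qed
    then show ?thesis by (simp add: radius_functions_def)
  qed
  have preimage: "NR_bounded (\<lambda>\<rho>. N (\<rho> / (4 * \<Lambda>\<^sup>2))) (T R) (M \<inter> f -` A) d"
    if "A \<subseteq> M'" "NR_bounded N R A d'" for A R
    unfolding T_def
    by (rule NR_bounded_preimage[OF M M' f \<Lambda> l _ _ that]) (simp_all add: lower upper)
  obtain R where R: "\<And>U. U \<in> \<U> \<Longrightarrow> NR_bounded N R U d'"
    using bdd by (auto simp: uniformly_N_bounded_def)
  have "N_bounded (\<lambda>\<rho>. N (\<rho> / (4 * \<Lambda>\<^sup>2))) (\<Union>\<F>) d"
    if \<F>: "\<F> \<subseteq> (\<lambda>U. M \<inter> f -` U) ` \<U>" "finite \<F>" for \<F>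
  proof -
    \<comment> \<open>Different members of \<U> may have equal preimages, so a finite subfamily
      representing \<F> has to be chosen.\<close>
    obtain \<G> where \<G>: "\<G> \<subseteq> \<U>" "finite \<G>" "\<F> = (\<lambda>U. M \<inter> f -` U) ` \<G>"
      using finite_subset_image[OF \<F>(2,1)] by blast
    then obtain Q where Q: "NR_bounded N Q (\<Union>\<G>) d'"
      using bdd unfolding uniformly_N_bounded_def N_bounded_def by blast
    have "\<Union>\<F> = M \<inter> f -` \<Union>\<G>" and "\<Union>\<G> \<subseteq> M'"
      using \<G> sub by auto
    then show ?thesis
      unfolding N_bounded_def using T[of Q] preimage[OF _ Q] by auto
  qed
  moreover have "\<forall>V\<in>(\<lambda>U. M \<inter> f -` U) ` \<U>. NR_bounded (\<lambda>\<rho>. N (\<rho> / (4 * \<Lambda>\<^sup>2))) (T R) V d"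
    using preimage sub R by blast
  ultimately show ?thesis
    unfolding uniformly_N_bounded_def using T by blast
qed

text \<open>A point outside the preimage of \<open>U\<close> is mapped outside \<open>U\<close>, and
  the upper estimate turns a distance above \<open>\<Lambda> * \<delta> + l\<close> between images
  into one above \<delta>. The strict inequality in the assumption yields a single \<open>U\<close>
  good for \<open>f x\<close>, without the supremum having to be attained.\<close>

lemma Lebesgue_number_preimage:
  fixes \<Lambda> l \<delta> :: real
  assumes f: "f \<in> M \<rightarrow> M'" and \<Lambda>: "\<Lambda> > 0" and \<delta>: "\<Lambda> * \<delta> + l \<ge> 0"
    and upper: "\<And>x y. x \<in> M \<Longrightarrow> y \<in> M \<Longrightarrow> d' (f x) (f y) \<le> \<Lambda> * d x y + l"
    and L: "Lebesgue_number M' d' \<U> > ennreal (\<Lambda> * \<delta> + l)"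
  shows "Lebesgue_number M d ((\<lambda>U. M \<inter> f -` U) ` \<U>) \<ge> ennreal \<delta>"
  unfolding Lebesgue_number_def
proof (rule INF_greatest)
  fix x assume x: "x \<in> M"
  have "ennreal (\<Lambda> * \<delta> + l) < (SUP U\<in>\<U>. dist_to_set d' (f x) (M' - U))"
    using L x f unfolding Lebesgue_number_def by (blast intro: less_le_trans INF_lower)
  then obtain U where U: "U \<in> \<U>" "ennreal (\<Lambda> * \<delta> + l) < dist_to_set d' (f x) (M' - U)"
    by (auto simp: less_SUP_iff)
  have "ennreal \<delta> \<le> dist_to_set d x (M - (M \<inter> f -` U))"
    unfolding dist_to_set_def
  proof (rule INF_greatest)
    fix y assume y: "y \<in> M - (M \<inter> f -` U)"
    then have "f y \<in> M' - U"
      using f by auto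
    then have "ennreal (\<Lambda> * \<delta> + l) < ennreal (d' (f x) (f y))"
      using U(2) unfolding dist_to_set_def by (blast intro: less_le_trans INF_lower)
    \<comment> \<open>Since \<open>ennreal\<close> sends negative reals to 0, the comparison is
      brought back to the reals using nonnegativity of the left side.\<close>
    then have "\<Lambda> * \<delta> + l < d' (f x) (f y)"
      using \<delta> by (simp add: ennreal_less_iff)
    then have "\<Lambda> * \<delta> < \<Lambda> * d x y"
      using upper[of x y] x y by auto
    then show "ennreal \<delta> \<le> ennreal (d x y)"
      using \<Lambda> by (intro ennreal_leI) simp
  qed
  then show "ennreal \<delta> \<le> (SUP U\<in>(\<lambda>U. M \<inter> f -` U) ` \<U>. dist_to_set d x (M - U))"
    using U(1) by (blast intro: SUP_upper2)
qed

text \<open>The preimages containing \<open>x\<close> come from the members containing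
  \<open>f x\<close>; coinciding preimages can only lower the count.\<close>

lemma multiplicity_le_preimage:
  assumes f: "f \<in> M \<rightarrow> M'" and m: "multiplicity_le M' \<U> m"
  shows "multiplicity_le M ((\<lambda>U. M \<inter> f -` U) ` \<U>) m"
  unfolding multiplicity_le_def
proof
  fix x assume x: "x \<in> M"
  let ?\<V> = "{U \<in> \<U>. f x \<in> U}"
  have eq: "{V \<in> (\<lambda>U. M \<inter> f -` U) ` \<U>. x \<in> V} = (\<lambda>U. M \<inter> f -` U) ` ?\<V>"
    using x by auto
  have "finite ?\<V>" "card ?\<V> \<le> m"
    using m x f by (auto simp: multiplicity_le_def)
  then show "finite {V \<in> (\<lambda>U. M \<inter> f -` U) ` \<U>. x \<in> V} \<and>
      card {V \<in> (\<lambda>U. M \<inter> f -` U) ` \<U>. x \<in> V} \<le> m"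
    unfolding eq using card_image_le le_trans by blast
qed

lemma covering_preimage:
  assumes "f \<in> M \<rightarrow> M'" and "covering M' \<U>"
  shows "covering M ((\<lambda>U. M \<inter> f -` U) ` \<U>)"
  using assms unfolding covering_def by fastforce

theorem theorem4p1:
  fixes X :: "'a set" and d :: "'a \<Rightarrow> 'a \<Rightarrow> real"
    and X' :: "'b set" and d' :: "'b \<Rightarrow> 'b \<Rightarrow> real"
    and f :: "'a \<Rightarrow> 'b"
  assumes "Metric_space X d"
    and "Metric_space X' d'"
    and "quasi_isometric_map X d X' d' f"
  shows "hypdim X d \<le> hypdim X' d'"
proof -
  obtain \<Lambda> l :: real where f: "f \<in> X \<rightarrow> X'" and \<Lambda>: "\<Lambda> \<ge> 1" and l: "l \<ge> 0"
    and lower: "\<And>x y. x \<in> X \<Longrightarrow> y \<in> X \<Longrightarrow> d x y / \<Lambda> - l \<le> d' (f x) (f y)"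
    and upper: "\<And>x y. x \<in> X \<Longrightarrow> y \<in> X \<Longrightarrow> d' (f x) (f y) \<le> \<Lambda> * d x y + l"
    using assms(3) unfolding quasi_isometric_map_def by auto
  \<comment> \<open>Every \<open>n\<close> admissible for \<open>X'\<close> is admissible for
    \<open>X\<close>, by pulling back a covering whose Lebesgue number is large compared with
    \<delta>.\<close>
  have "\<exists>N \<U>. covering X \<U> \<and> uniformly_N_bounded N \<U> d \<and>
      Lebesgue_number X d \<U> \<ge> ennreal \<delta> \<and> multiplicity_le X \<U> (n + 1)"
    if n: "\<forall>\<delta>>0. \<exists>N \<U>. covering X' \<U> \<and> uniformly_N_bounded N \<U> d' \<and>
      Lebesgue_number X' d' \<U> \<ge> ennreal \<delta> \<and> multiplicity_le X' \<U> (n + 1)"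
      and \<delta>: "\<delta> > 0" for n :: nat and \<delta> :: real
  proof -
    have pos: "\<Lambda> * \<delta> + l \<ge> 0"
      using \<Lambda> l \<delta> by simp
    \<comment> \<open>The extra 1 turns the non-strict bound in the definition of
      \<open>hypdim\<close> into the strict one required for the pullback.\<close>
    then have "\<Lambda> * \<delta> + l + 1 > 0"
      by linarith
    then obtain N \<U> where \<U>: "covering X' \<U>" "uniformly_N_bounded N \<U> d'"
        "Lebesgue_number X' d' \<U> \<ge> ennreal (\<Lambda> * \<delta> + l + 1)" "multiplicity_le X' \<U> (n + 1)"
      using n by blast
    have "ennreal (\<Lambda> * \<delta> + l) < ennreal (\<Lambda> * \<delta> + l + 1)"
      using pos by (simp add: ennreal_less_iff)
    then have L: "ennreal (\<Lambda> * \<delta> + l) < Lebesgue_number X' d' \<U>"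
      using \<U>(3) by (rule less_le_trans)
    have sub: "\<And>U. U \<in> \<U> \<Longrightarrow> U \<subseteq> X'"
      using \<U>(1) by (auto simp: covering_def)
    have "\<Lambda> > 0"
      using \<Lambda> by linarith
    then show ?thesis
      using covering_preimage[OF f \<U>(1)] multiplicity_le_preimage[OF f \<U>(4)]
        Lebesgue_number_preimage[OF f _ pos upper L]
        uniformly_N_bounded_preimage[OF assms(1,2) f \<Lambda> l lower upper sub \<U>(2)]
      by blast
  qed
  \<comment> \<open>The infimum for \<open>X\<close> runs over a larger set of integers, hence is no
    larger; if no \<open>n\<close> is admissible for \<open>X'\<close>, the right side is
    \<infinity>.\<close>
  then show ?thesis
    unfolding hypdim_def by (intro INF_superset_mono) auto
qed

end
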